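(* Let $\mathcal{Z}\subset\mathbb{R}^d$ be nonempty, closed and convex, let $F:\mathcal{Z}\to\mathbb{R}^d$ be a continuous monotone operator, let $z_t\in\mathcal{Z}$ and $\eta_t>0$, and let $w_t=\mathrm{Proj}_{\mathcal{Z}}(z_t-\eta_tF(z_t))$ and $z_{t+1}=\mathrm{Proj}_{\mathcal{Z}}(z_t-\eta_tF(w_t))$. Let $\xi_{t+1}=-\frac1{\eta_t}\left[z_{t+1}-(z_t-\eta_tF(w_t))\right]$. Then $$\|F(z_{t+1})+\xi_{t+1}\|_2\ \ge\ T(z_{t+1}),$$ where $T$ denotes the tangent residual.
   Context: $\mathrm{Proj}_{C}$ is the Euclidean projection onto a closed convex set $C$. For $z\in\mathcal{Z}$ the normal cone is $\mathcal{N}_{\mathcal{Z}}(z)=\{\xi\in\mathbb{R}^d:\langle\xi,w-z\rangle\le0\ \ \forall w\in\mathcal{Z}\}$. The tangent residual is $T(z)=\|F(z)+\mathrm{Proj}_{\mathcal{N}_{\mathcal{Z}}(z)}(-F(z))\|_2$. $F$ is monotone if $\langle F(z)-F(w),z-w\rangle\ge0$ for all $z,w\in\mathcal{Z}$. *)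

theory Defs
  imports "HOL-Analysis.Analysis"
begin

definition normal_cone :: "(real ^ 'd) set \<Rightarrow> real ^ 'd \<Rightarrow> (real ^ 'd) set"
  where "normal_cone Z z = {\<xi>. \<forall>w\<in>Z. \<xi> \<bullet> (w - z) \<le> 0}"

definition monotone_operator_on :: "(real ^ 'd) set \<Rightarrow> (real ^ 'd \<Rightarrow> real ^ 'd) \<Rightarrow> bool"
  where "monotone_operator_on Z F \<longleftrightarrow> (\<forall>z\<in>Z. \<forall>w\<in>Z. (F z - F w) \<bullet> (z - w) \<ge> 0)"

(* closest_point is the Euclidean projection: a normal cone is nonempty, closed and
   convex, so the nearest point exists and is unique.  The residual depends on Z, F
   and z; it is meant for z in Z. *)
definition tangent_residual ::
    "(real ^ 'd) set \<Rightarrow> (real ^ 'd \<Rightarrow> real ^ 'd) \<Rightarrow> real ^ 'd \<Rightarrow> real"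
  where "tangent_residual Z F z = norm (F z + closest_point (normal_cone Z z) (- F z))"

end

theory Submission
  imports Defs
begin

text \<open>The residual at \<open>z'\<close> is the distance from \<open>- F z'\<close> to the
  normal cone at \<open>z'\<close>, so every element of that cone yields an upper bound for it
  (\<open>tangent_residual_le\<close>). The vector \<open>\<xi>\<close> is such an element: it is
  \<open>1 / \<eta>\<close> times the displacement removed by the projection that produces
  \<open>z'\<close> (\<open>scaled_projection_residual_in_normal_cone\<close>).\<close>

lemma closed_normal_cone: "closed (normal_cone Z z)"
proof -
  have "normal_cone Z z = (\<Inter>w\<in>Z. {\<xi>. (w - z) \<bullet> \<xi> \<le> 0})"
    by (auto simp: normal_cone_def inner_commute)
  then show ?thesis
    by (auto intro: closed_halfspace_le)
qed

text \<open>The projection minimises the distance to \<open>- F z\<close> over the cone, and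
  \<open>\<xi>\<close> is one competitor; closedness ensures that the minimum is attained.\<close>

lemma tangent_residual_le:
  assumes "\<xi> \<in> normal_cone Z z"
  shows "tangent_residual Z F z \<le> norm (F z + \<xi>)"
proof -
  have "norm (- F z - closest_point (normal_cone Z z) (- F z)) \<le> norm (- F z - \<xi>)"
    using closest_point_le [OF closed_normal_cone assms] by (simp add: dist_norm)
  moreover have "norm (- F z - v) = norm (F z + v)" for v
    using norm_minus_cancel [of "F z + v"] by simp
  ultimately show ?thesis
    by (simp add: tangent_residual_def)
qed

text \<open>Variational inequality of the projection: \<open>a - closest_point Z a\<close> makes no
  acute angle with any direction from the projection into \<open>Z\<close>, and scaling by
  \<open>c \<ge> 0\<close> keeps the sign.\<close>

lemma scaled_projection_residual_in_normal_cone: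
  assumes "closed Z" "convex Z" "c \<ge> 0"
  shows "c *\<^sub>R (a - closest_point Z a) \<in> normal_cone Z (closest_point Z a)"
  using closest_point_dot [OF assms(2,1)] assms(3)
  by (auto simp: normal_cone_def intro: mult_nonneg_nonpos)

theorem lemma3:
  fixes Z :: "(real ^ 'd) set"
    and F :: "real ^ 'd \<Rightarrow> real ^ 'd"
    and z w z' \<xi> :: "real ^ 'd"
    and \<eta> :: real
  assumes "Z \<noteq> {}" and "closed Z" and "convex Z"
    and "continuous_on Z F" and "monotone_operator_on Z F"
    and "z \<in> Z" and "\<eta> > 0"
    and "w = closest_point Z (z - \<eta> *\<^sub>R F z)"
    and "z' = closest_point Z (z - \<eta> *\<^sub>R F w)"
    and "\<xi> = - (1 / \<eta>) *\<^sub>R (z' - (z - \<eta> *\<^sub>R F w))"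
  shows "norm (F z' + \<xi>) \<ge> tangent_residual Z F z'"
proof (rule tangent_residual_le)
  \<comment> \<open>Moving the minus sign inside exhibits \<open>\<xi>\<close> as point minus
    projection, with \<open>c = 1 / \<eta>\<close>.\<close>
  have "\<xi> = (1 / \<eta>) *\<^sub>R ((z - \<eta> *\<^sub>R F w) - z')"
    unfolding assms(10) by (simp only: scaleR_minus_left scaleR_minus_right [symmetric] minus_diff_eq)
  then show "\<xi> \<in> normal_cone Z z'"
    using scaled_projection_residual_in_normal_cone [OF assms(2,3), of "1 / \<eta>" "z - \<eta> *\<^sub>R F w"] assms(7)
    by (simp add: assms(9))
qed

end
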